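(* (i) Let $\mathbb{A}$ be a locally complex algebra and let $k>1$ be a given natural number. Then there exists at most one nonzero vector space norm $\|\cdot\|$ on $\mathbb{A}$ satisfying the identity $\|x^k\|=\|x\|^k$ on $\mathbb{A}$. Therefore, the only nonzero real vector space norm $\|\cdot\|$ on $\mathbb{R}_n$, the real Cayley–Dickson algebra of dimension $2^n$ with $n$ a nonnegative integer, satisfying the identity $\|x^k\|=\|x\|^k$ on $\mathbb{R}_n$ is its Euclidean norm $|\cdot|$, given by $|x|=\sqrt{\sum_{i=1}^{2^n}x_i^2}$ for $x=(x_i)_{i=1}^{2^n}\in\mathbb{R}_n$. (ii) There exists at most one absolute value on any locally complex algebra. In particular, the Euclidean norm is the only absolute value on each of $\mathbb{R}$, $\mathbb{C}$, $\mathbb{H}$, and $\mathbb{O}$. (iii) Let $\mathbb{A}$ be a locally complex algebra. Then, up to multiplication by a positive scalar, there exists at most one vector space norm $\|\cdot\|$ on $\mathbb{A}$ satisfying $$\inf\{\|xy\|:\|x\|=\|y\|=1\}=\sup\{\|xy\|:\|x\|=\|y\|=1\}.$$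
   Context: Algebras are nonzero and not necessarily associative or commutative. A unital algebra is quadratic if the unital subalgebra generated by any element is at most two-dimensional (such algebras are power-associative). A real quadratic algebra is locally complex if the unital subalgebra generated by any element is a field extension of $\mathbb{R}$ (i.e. isomorphic to $\mathbb{R}$ or $\mathbb{C}$). An absolute value on a real algebra is a real vector space norm with $\|ab\|=\|a\|\|b\|$ for all $a,b$. $\mathbb{H}$ and $\mathbb{O}$ are the real algebras of quaternions and octonions. The real Cayley–Dickson algebras are obtained from $\mathbb{R}_0=\mathbb{R}$ by the standard doubling process: $\mathbb{R}_{n+1}=\mathbb{R}_n\times\mathbb{R}_n$ with $(a,b)(c,d)=(ac-d^*b,\,da+bc^* )$, $(a,b)^*=(a^*,-b)$; in particular $\mathbb{R}_1=\mathbb{C}$, $\mathbb{R}_2=\mathbb{H}$, $\mathbb{R}_3=\mathbb{O}$; as a vector space $\mathbb{R}_n=\mathbb{R}^{2^n}$. *)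

theory Defs
  imports "HOL-Analysis.Analysis" "HOL-Algebra.Ring" "HOL-Library.Function_Algebras"
begin

section \<open>Real algebras\<close>

text \<open>
  An algebra is a subspace \<open>A\<close> of some real vector space together with a product and a unit, and
  all conditions are relativised to \<open>A\<close>. The choice \<open>A = UNIV\<close> covers algebras on a whole type;
  proper subspaces are needed because the Cayley--Dickson algebras below share one type.
  Neither associativity nor commutativity is assumed.
\<close>

locale real_unital_algebra =
  fixes A :: "'a::real_vector set"
    and prd :: "'a \<Rightarrow> 'a \<Rightarrow> 'a"  (infixl \<open>\<bullet>\<^sub>A\<close> 70)
    and unt :: 'a
  assumes subspace_carrier: "subspace A"
    and nonzero: "\<exists>x\<in>A. x \<noteq> 0"
    and prd_closed: "\<lbrakk>x \<in> A; y \<in> A\<rbrakk> \<Longrightarrow> x \<bullet>\<^sub>A y \<in> A"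
    and prd_add_left: "\<lbrakk>x \<in> A; y \<in> A; z \<in> A\<rbrakk> \<Longrightarrow> (x + y) \<bullet>\<^sub>A z = x \<bullet>\<^sub>A z + y \<bullet>\<^sub>A z"
    and prd_add_right: "\<lbrakk>x \<in> A; y \<in> A; z \<in> A\<rbrakk> \<Longrightarrow> x \<bullet>\<^sub>A (y + z) = x \<bullet>\<^sub>A y + x \<bullet>\<^sub>A z"
    and prd_scale_left: "\<lbrakk>x \<in> A; y \<in> A\<rbrakk> \<Longrightarrow> (r *\<^sub>R x) \<bullet>\<^sub>A y = r *\<^sub>R (x \<bullet>\<^sub>A y)"
    and prd_scale_right: "\<lbrakk>x \<in> A; y \<in> A\<rbrakk> \<Longrightarrow> x \<bullet>\<^sub>A (r *\<^sub>R y) = r *\<^sub>R (x \<bullet>\<^sub>A y)"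
    and unt_closed: "unt \<in> A"
    and unt_left: "x \<in> A \<Longrightarrow> unt \<bullet>\<^sub>A x = x"
    and unt_right: "x \<in> A \<Longrightarrow> x \<bullet>\<^sub>A unt = x"
begin

definition unital_subalgebra :: "'a set \<Rightarrow> bool" where
  "unital_subalgebra S \<longleftrightarrow>
     S \<subseteq> A \<and> subspace S \<and> unt \<in> S \<and> (\<forall>x\<in>S. \<forall>y\<in>S. x \<bullet>\<^sub>A y \<in> S)"

definition generated :: "'a \<Rightarrow> 'a set" where
  "generated a = unital_subalgebra hull {a}"

definition generated_ring :: "'a \<Rightarrow> 'a ring" where
  "generated_ring a =
     \<lparr>carrier = generated a, monoid.mult = prd, one = unt, zero = 0, add = (+)\<rparr>"

end

text \<open>
  ``At most two-dimensional'' is expressed by a spanning set with at most two elements, since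
  \<^const>\<open>dim\<close> is \<open>0\<close> on infinite-dimensional spaces.
\<close>

locale real_quadratic_algebra = real_unital_algebra +
  assumes generated_dim_le_2:
    "a \<in> A \<Longrightarrow> \<exists>B. finite B \<and> card B \<le> 2 \<and> generated a = span B"

text \<open>
  Each \<open>generated a\<close> contains the scalar multiples of the unit, hence a copy of the reals, so it is
  a field extension of the reals as soon as it is a field.
\<close>

locale locally_complex_algebra = real_quadratic_algebra +
  assumes generated_field: "a \<in> A \<Longrightarrow> field (generated_ring a)"

text \<open>The bracketing of powers is immaterial, as quadratic algebras are power-associative.\<close>

primrec alg_power :: "('a \<Rightarrow> 'a \<Rightarrow> 'a) \<Rightarrow> 'a \<Rightarrow> 'a \<Rightarrow> nat \<Rightarrow> 'a" where
  "alg_power prd unt x 0 = unt"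
| "alg_power prd unt x (Suc k) = prd x (alg_power prd unt x k)"


section \<open>Norms\<close>

text \<open>Norms are functions on the ambient type; only their values on \<open>A\<close> are meaningful.\<close>

definition vector_norm_on :: "'a::real_vector set \<Rightarrow> ('a \<Rightarrow> real) \<Rightarrow> bool" where
  "vector_norm_on A N \<longleftrightarrow>
     (\<forall>x\<in>A. 0 \<le> N x) \<and>
     (\<forall>x\<in>A. N x = 0 \<longleftrightarrow> x = 0) \<and>
     (\<forall>r. \<forall>x\<in>A. N (r *\<^sub>R x) = \<bar>r\<bar> * N x) \<and>
     (\<forall>x\<in>A. \<forall>y\<in>A. N (x + y) \<le> N x + N y)"

definition absolute_value_on ::
    "'a::real_vector set \<Rightarrow> ('a \<Rightarrow> 'a \<Rightarrow> 'a) \<Rightarrow> ('a \<Rightarrow> real) \<Rightarrow> bool" where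
  "absolute_value_on A prd N \<longleftrightarrow>
     vector_norm_on A N \<and> (\<forall>x\<in>A. \<forall>y\<in>A. N (prd x y) = N x * N y)"

definition power_norm_on ::
    "'a::real_vector set \<Rightarrow> ('a \<Rightarrow> 'a \<Rightarrow> 'a) \<Rightarrow> 'a \<Rightarrow> nat \<Rightarrow> ('a \<Rightarrow> real) \<Rightarrow> bool" where
  "power_norm_on A prd unt k N \<longleftrightarrow>
     vector_norm_on A N \<and> (\<exists>x\<in>A. N x \<noteq> 0) \<and>
     (\<forall>x\<in>A. N (alg_power prd unt x k) = N x ^ k)"

text \<open>
  The values are extended reals because the product need not be bounded, in which case the
  supremum of the set is \<open>\<infinity>\<close>.
\<close>

definition unit_product_norms ::
    "'a set \<Rightarrow> ('a \<Rightarrow> 'a \<Rightarrow> 'a) \<Rightarrow> ('a \<Rightarrow> real) \<Rightarrow> ereal set" where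
  "unit_product_norms A prd N =
     {ereal (N (prd x y)) | x y. x \<in> A \<and> y \<in> A \<and> N x = 1 \<and> N y = 1}"


section \<open>The real Cayley--Dickson algebras\<close>

instantiation "fun" :: (type, real_vector) real_vector
begin

definition scaleR_fun :: "real \<Rightarrow> ('a \<Rightarrow> 'b) \<Rightarrow> 'a \<Rightarrow> 'b" where
  "scaleR_fun r f = (\<lambda>x. r *\<^sub>R f x)"

instance
  by standard (auto simp: scaleR_fun_def fun_eq_iff scaleR_add_right scaleR_add_left)

end

text \<open>
  The \<open>n\<close>-th algebra has as carrier the sequences vanishing from index \<open>2 ^ n\<close> on. A sequence in
  \<open>cd_carrier (Suc n)\<close> stands for the pair consisting of its entries with index below \<open>2 ^ n\<close> and
  its remaining entries.
\<close>

definition cd_carrier :: "nat \<Rightarrow> (nat \<Rightarrow> real) set" where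
  "cd_carrier n = {x. \<forall>i\<ge>2 ^ n. x i = 0}"

definition cd_pair :: "nat \<Rightarrow> (nat \<Rightarrow> real) \<Rightarrow> (nat \<Rightarrow> real) \<Rightarrow> nat \<Rightarrow> real" where
  "cd_pair n a b = (\<lambda>i. if i < 2 ^ n then a i else b (i - 2 ^ n))"

definition cd_fst :: "nat \<Rightarrow> (nat \<Rightarrow> real) \<Rightarrow> nat \<Rightarrow> real" where
  "cd_fst n x = (\<lambda>i. if i < 2 ^ n then x i else 0)"

definition cd_snd :: "nat \<Rightarrow> (nat \<Rightarrow> real) \<Rightarrow> nat \<Rightarrow> real" where
  "cd_snd n x = (\<lambda>i. x (2 ^ n + i))"

primrec cd_conj :: "nat \<Rightarrow> (nat \<Rightarrow> real) \<Rightarrow> nat \<Rightarrow> real" where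
  "cd_conj 0 x = x"
| "cd_conj (Suc n) x = cd_pair n (cd_conj n (cd_fst n x)) (- cd_snd n x)"

primrec cd_mult :: "nat \<Rightarrow> (nat \<Rightarrow> real) \<Rightarrow> (nat \<Rightarrow> real) \<Rightarrow> nat \<Rightarrow> real" where
  "cd_mult 0 x y = (\<lambda>i. x i * y i)"
| "cd_mult (Suc n) x y =
     (let a = cd_fst n x; b = cd_snd n x; c = cd_fst n y; d = cd_snd n y in
       cd_pair n (cd_mult n a c - cd_mult n (cd_conj n d) b)
                 (cd_mult n d a + cd_mult n b (cd_conj n c)))"

definition cd_one :: "nat \<Rightarrow> real" where
  "cd_one = (\<lambda>i. if i = 0 then 1 else 0)"

definition cd_norm :: "nat \<Rightarrow> (nat \<Rightarrow> real) \<Rightarrow> real" where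
  "cd_norm n x = sqrt (\<Sum>i<2 ^ n. (x i)\<^sup>2)"

lemma cd_carrier_Suc:
  "bij_betw (\<lambda>(a, b). cd_pair n a b) (cd_carrier n \<times> cd_carrier n) (cd_carrier (Suc n))"
  by (rule bij_betw_byWitness[where f' = "\<lambda>x. (cd_fst n x, cd_snd n x)"])
     (auto simp: cd_carrier_def cd_pair_def cd_fst_def cd_snd_def fun_eq_iff)

lemma cd_conj_pair:
  assumes "a \<in> cd_carrier n" "b \<in> cd_carrier n"
  shows "cd_conj (Suc n) (cd_pair n a b) = cd_pair n (cd_conj n a) (- b)"
proof -
  have "cd_fst n (cd_pair n a b) = a" "cd_snd n (cd_pair n a b) = b"
    using assms by (auto simp: cd_carrier_def cd_pair_def cd_fst_def cd_snd_def fun_eq_iff)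
  then show ?thesis by simp
qed

lemma cd_mult_pair:
  assumes "a \<in> cd_carrier n" "b \<in> cd_carrier n" "c \<in> cd_carrier n" "d \<in> cd_carrier n"
  shows "cd_mult (Suc n) (cd_pair n a b) (cd_pair n c d) =
    cd_pair n (cd_mult n a c - cd_mult n (cd_conj n d) b)
              (cd_mult n d a + cd_mult n b (cd_conj n c))"
proof -
  have "cd_fst n (cd_pair n a b) = a" "cd_snd n (cd_pair n a b) = b"
       "cd_fst n (cd_pair n c d) = c" "cd_snd n (cd_pair n c d) = d"
    using assms by (auto simp: cd_carrier_def cd_pair_def cd_fst_def cd_snd_def fun_eq_iff)
  then show ?thesis by (simp add: Let_def)
qed

end

theory Submission
  imports Defs
begin

text \<open>
  Every element of a locally complex algebra is a multiple of the unit or lies in a copy of the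
  complex plane. A norm on that plane is comparable to the modulus by compactness; if it is
  compatible with \<open>k\<close>-th powers, comparing both at \<open>z ^ (k ^ m)\<close> and letting \<open>m\<close> grow shows
  that it equals the modulus. An absolute value is the case \<open>k = 2\<close>, and a norm with
  constant \<open>\<parallel>x y\<parallel>\<close> on unit vectors becomes an absolute value after division by the norm of the
  unit. In the Cayley--Dickson algebras \<open>x\<^sup>* x = |x|\<^sup>2\<close>, so imaginary elements of norm \<open>1\<close> square to
  \<open>-1\<close> and the Euclidean norm is the modulus on each plane. It is multiplicative on a double as
  soon as it is on the algebra itself and that algebra is associative.
\<close>

section \<open>Power-multiplicative norms on the complex plane\<close>

lemma power_iterate:
  fixes M :: "'b::monoid_mult \<Rightarrow> 'c::monoid_mult"
  assumes "\<And>z. M (z ^ k) = M z ^ k"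
  shows "M (z ^ (k ^ m)) = M z ^ (k ^ m)"
proof (induction m)
  case (Suc m)
  have "M (z ^ (k ^ Suc m)) = M ((z ^ (k ^ m)) ^ k)"
    by (simp add: power_mult[symmetric] mult.commute)
  also have "\<dots> = (M z ^ (k ^ m)) ^ k"
    by (simp only: assms Suc)
  finally show ?case
    by (simp add: power_mult[symmetric] mult.commute)
qed simp

text \<open>A base above 1 has unbounded powers, and \<open>k ^ m\<close> is at least
  \<open>m\<close>, so the exponents \<open>k ^ m\<close> already reach them. The base will be the
  ratio of two norms.\<close>

lemma le_one_if_iterates_bounded:
  fixes q B :: real
  assumes "k > 1" "\<And>m. q ^ (k ^ m) \<le> B"
  shows "q \<le> 1"
proof (rule ccontr)
  assume "\<not> q \<le> 1"
  then have q: "q > 1" by simp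
  then obtain m where m: "B < q ^ m" using real_arch_pow by blast
  have "m \<le> k ^ m" using \<open>k > 1\<close> by (simp add: less_imp_le power_gt_expt)
  then have "q ^ m \<le> q ^ (k ^ m)" using q by (simp add: power_increasing)
  with m assms(2)[of m] show False by simp
qed

lemma vector_norm_onD:
  assumes "vector_norm_on A N"
  shows "x \<in> A \<Longrightarrow> 0 \<le> N x"
    and "x \<in> A \<Longrightarrow> N x = 0 \<longleftrightarrow> x = 0"
    and "x \<in> A \<Longrightarrow> N (r *\<^sub>R x) = \<bar>r\<bar> * N x"
    and "x \<in> A \<Longrightarrow> y \<in> A \<Longrightarrow> N (x + y) \<le> N x + N y"
  using assms unfolding vector_norm_on_def by simp_all

text \<open>Triangle inequality in the coordinates \<open>Re z\<close> and \<open>Im z\<close>, each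
  bounded by the modulus.\<close>

lemma complex_vector_norm_upper:
  assumes "vector_norm_on UNIV M"
  shows "M z \<le> (M 1 + M \<i>) * cmod z"
proof -
  note M = vector_norm_onD[OF assms, simplified]
  have "M z = M (Re z *\<^sub>R 1 + Im z *\<^sub>R \<i>)"
    by (rule arg_cong[of _ _ M]) (simp add: complex_eq_iff)
  also have "\<dots> \<le> \<bar>Re z\<bar> * M 1 + \<bar>Im z\<bar> * M \<i>"
    using M(4)[of "Re z *\<^sub>R 1" "Im z *\<^sub>R \<i>"] by (simp only: M(3))
  also have "\<dots> \<le> cmod z * M 1 + cmod z * M \<i>"
    by (intro add_mono mult_right_mono abs_Re_le_cmod abs_Im_le_cmod M(1))
  finally show ?thesis by (simp add: algebra_simps)
qed

text \<open>By the upper bound and the reverse triangle inequality \<open>M\<close> is Lipschitz, so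
  it attains a minimum on the compact unit circle. The minimum is positive because \<open>M\<close>
  vanishes only at 0, and homogeneity carries the bound to all \<open>z\<close>.\<close>

lemma complex_vector_norm_lower:
  assumes "vector_norm_on UNIV M"
  obtains c where "c > 0" "\<And>z. c * cmod z \<le> M z"
proof -
  note M = vector_norm_onD[OF assms, simplified]
  define B where "B = M 1 + M \<i>"
  have le: "M x - M y \<le> B * dist x y" for x y
    using M(4)[of "x - y" y] complex_vector_norm_upper[OF assms, of "x - y"]
    by (simp add: B_def dist_norm)
  have "B-lipschitz_on UNIV M"
  proof (rule lipschitz_onI)
    fix x y
    show "dist (M x) (M y) \<le> B * dist x y"
      using le[of x y] le[of y x] by (simp add: dist_real_def dist_commute abs_le_iff)
  qed (simp add: B_def M(1))
  then have "continuous_on (sphere 0 1) M"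
    by (meson continuous_on_subset lipschitz_on_continuous_on top_greatest)
  then obtain w where w: "w \<in> sphere 0 1" "\<forall>z\<in>sphere 0 1. M w \<le> M z"
    using continuous_attains_inf[of "sphere (0::complex) 1" M] by auto
  have "w \<noteq> 0" using w(1) by auto
  then have "M w > 0" using M(1,2)[of w] by linarith
  moreover have "M w * cmod z \<le> M z" for z
  proof (cases "z = 0")
    case False
    then have "M w \<le> M ((1 / cmod z) *\<^sub>R z)"
      using w(2) by (simp add: dist_norm)
    also have "\<dots> = M z / cmod z" by (simp only: M(3)) (simp add: field_simps)
    finally show ?thesis using False by (simp add: field_simps)
  qed (simp add: M(1))
  ultimately show thesis using that by blast
qed

lemma complex_power_norm_unique:
  assumes N: "vector_norm_on UNIV M" and "k > 1"
    and pow: "\<And>z. M (z ^ k) = M z ^ k"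
  shows "M z = cmod z"
proof (cases "z = 0")
  case True
  then show ?thesis using vector_norm_onD(2)[OF N] by simp
next
  case False
  define B where "B = M 1 + M \<i>"
  obtain c where c: "c > 0" "\<And>z. c * cmod z \<le> M z"
    using complex_vector_norm_lower[OF N] by blast
  \<comment> \<open>Both norms turn \<open>z ^ (k ^ m)\<close> into a power of their value at
    \<open>z\<close>, while \<open>c\<close> and \<open>B\<close> do not depend on \<open>m\<close>.
    So both ratios of the norms have bounded iterated powers.\<close>
  have "c * cmod z ^ (k ^ m) \<le> M z ^ (k ^ m)" "M z ^ (k ^ m) \<le> B * cmod z ^ (k ^ m)" for m
    using c(2)[of "z ^ (k ^ m)"] complex_vector_norm_upper[OF N, of "z ^ (k ^ m)"]
    by (simp_all add: power_iterate[of M, OF pow] norm_power B_def)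
  moreover have pos: "cmod z > 0" "M z > 0"
    using False vector_norm_onD(1,2)[OF N, of z] by (simp_all add: less_le)
  ultimately have "(M z / cmod z) ^ (k ^ m) \<le> B" "(cmod z / M z) ^ (k ^ m) \<le> 1 / c" for m
    using c(1) by (simp_all add: power_divide field_simps)
  then have "M z / cmod z \<le> 1" "cmod z / M z \<le> 1"
    using le_one_if_iterates_bounded[OF \<open>k > 1\<close>] by blast+
  then show ?thesis using pos by simp
qed

section \<open>Norms on algebras with complex subalgebras\<close>

context real_unital_algebra
begin

section \<open>Copies of the complex numbers in a real algebra\<close>

lemma unt_nonzero: "unt \<noteq> 0"
proof
  assume "unt = 0"
  then have "x = 0" if "x \<in> A" for x
    using unt_left[OF that] prd_scale_left[OF unt_closed that, of 0] by simp
  then show False using nonzero by blast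
qed

lemma alg_power_closed: "x \<in> A \<Longrightarrow> alg_power prd unt x k \<in> A"
  by (induction k) (auto simp: unt_closed prd_closed)

lemma alg_power_unt: "alg_power prd unt unt k = unt"
  by (induction k) (auto simp: unt_closed unt_left)

text \<open>Meant for \<open>j\<close> with \<open>prd j j = - unt\<close>; it is then an injective
  homomorphism of real algebras sending \<open>\<i>\<close> to \<open>j\<close>.\<close>

definition embed_complex :: "'a \<Rightarrow> complex \<Rightarrow> 'a" where
  "embed_complex j z = Re z *\<^sub>R unt + Im z *\<^sub>R j"

lemma embed_complex_closed: "j \<in> A \<Longrightarrow> embed_complex j z \<in> A"
  by (simp add: embed_complex_def subspace_add subspace_scale subspace_carrier unt_closed)

lemma embed_complex_mult:
  assumes "j \<in> A" "prd j j = - unt"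
  shows "embed_complex j (z * w) = prd (embed_complex j z) (embed_complex j w)"
  using assms unfolding embed_complex_def
  by (simp add: subspace_add subspace_scale subspace_carrier unt_closed prd_closed prd_add_left
      prd_add_right prd_scale_left prd_scale_right unt_left unt_right algebra_simps)

lemma embed_complex_power:
  assumes "j \<in> A" "prd j j = - unt"
  shows "embed_complex j (z ^ k) = alg_power prd unt (embed_complex j z) k"
proof (induction k)
  case 0
  then show ?case by (simp add: embed_complex_def)
next
  case (Suc k)
  then show ?case by (simp add: embed_complex_mult[OF assms])
qed

text \<open>Multiplying by the image of \<open>cnj z\<close> turns a zero image into
  \<open>(cmod z)\<^sup>2 *\<^sub>R unt = 0\<close>, and the unit is nonzero.\<close>

lemma embed_complex_eq_0_iff:
  assumes "j \<in> A" "prd j j = - unt"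
  shows "embed_complex j z = 0 \<longleftrightarrow> z = 0"
proof
  assume "embed_complex j z = 0"
  moreover have "prd (embed_complex j (cnj z)) 0 = 0"
    using prd_scale_right[OF embed_complex_closed[OF assms(1)] unt_closed, of "cnj z" 0] by simp
  ultimately have "embed_complex j (cnj z * z) = 0"
    by (simp add: embed_complex_mult[OF assms])
  then have "(cmod z)\<^sup>2 *\<^sub>R unt = 0"
    by (simp only: mult.commute[of "cnj z"] flip: complex_norm_square) (simp add: embed_complex_def)
  then show "z = 0" using unt_nonzero by simp
qed (simp add: embed_complex_def)

text \<open>The unit is its own \<open>k\<close>-th power, so \<open>N unt\<close> is a positive
  fixed point of \<open>t ^ k\<close>; for \<open>k > 1\<close> only 1 qualifies.\<close>

lemma power_norm_unt:
  assumes "k > 1" "power_norm_on A prd unt k N"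
  shows "N unt = 1"
proof -
  have N: "vector_norm_on A N" "N unt = N unt ^ k"
    using assms(2) unt_closed alg_power_unt unfolding power_norm_on_def by metis+
  then have "N unt > 0"
    using vector_norm_onD(1,2)[OF N(1) unt_closed] unt_nonzero by linarith
  moreover obtain m where "k = Suc m" "m > 0" using assms(1) by (cases k) auto
  ultimately show ?thesis using N(2) by (auto simp: power_eq_1_iff dest: power_eq_imp_eq_base[of _ m 1, simplified])
qed

lemma power_norm_scaled_unt:
  assumes "k > 1" "power_norm_on A prd unt k N"
  shows "N (r *\<^sub>R unt) = \<bar>r\<bar>"
proof -
  have "vector_norm_on A N" using assms(2) unfolding power_norm_on_def by simp
  from vector_norm_onD(3)[OF this unt_closed] show ?thesis
    using power_norm_unt[OF assms] by simp
qed

text \<open>The embedding is linear, injective and respects powers, so \<open>N\<close> pulls back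
  to a norm on the complex plane compatible with \<open>k\<close>-th powers, and that norm is the
  modulus.\<close>

lemma power_norm_embed_complex:
  assumes "k > 1" "power_norm_on A prd unt k N" "j \<in> A" "prd j j = - unt"
  shows "N (embed_complex j z) = cmod z"
proof -
  have N: "vector_norm_on A N" and pow: "\<And>x. x \<in> A \<Longrightarrow> N (alg_power prd unt x k) = N x ^ k"
    using assms(2) unfolding power_norm_on_def by auto
  note cl = embed_complex_closed[OF assms(3)]
  have lin: "embed_complex j (r *\<^sub>R z) = r *\<^sub>R embed_complex j z"
    "embed_complex j (z + w) = embed_complex j z + embed_complex j w" for r z w
    by (simp_all add: embed_complex_def algebra_simps)
  have "vector_norm_on UNIV (\<lambda>z. N (embed_complex j z))"
    unfolding vector_norm_on_def
    by (auto simp: lin vector_norm_onD[OF N] cl embed_complex_eq_0_iff[OF assms(3,4)]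
        simp del: scaleR_complex.simps scaleR_conv_of_real)
  moreover have "N (embed_complex j (z ^ k)) = N (embed_complex j z) ^ k" for z
    by (simp add: embed_complex_power[OF assms(3,4)] pow cl)
  ultimately show ?thesis using complex_power_norm_unique[OF _ assms(1)] by blast
qed

text \<open>Multiples of the unit form a separate case because the algebra may contain no square
  root of \<open>- unt\<close>, as over the reals.\<close>

definition complex_element :: "'a \<Rightarrow> bool" where
  "complex_element x \<longleftrightarrow>
     (\<exists>r. x = r *\<^sub>R unt) \<or> (\<exists>j z. j \<in> A \<and> prd j j = - unt \<and> x = embed_complex j z)"

lemma power_norm_unique:
  assumes "complex_element x" "k > 1"
    "power_norm_on A prd unt k N" "power_norm_on A prd unt k N'"
  shows "N x = N' x"
  using assms(1) unfolding complex_element_def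
  by (elim disjE exE conjE)
    (simp_all add: power_norm_scaled_unt[OF assms(2,3)] power_norm_scaled_unt[OF assms(2,4)]
      power_norm_embed_complex[OF assms(2,3)] power_norm_embed_complex[OF assms(2,4)])

section \<open>Absolute values and norms with constant products of unit vectors\<close>

lemma absolute_value_imp_power_norm:
  assumes "absolute_value_on A prd N"
  shows "power_norm_on A prd unt 2 N"
  unfolding power_norm_on_def
proof (intro conjI ballI)
  show N: "vector_norm_on A N" using assms unfolding absolute_value_on_def by simp
  show "\<exists>x\<in>A. N x \<noteq> 0" using nonzero vector_norm_onD(2)[OF N] by blast
  show "N (alg_power prd unt x 2) = (N x)\<^sup>2" if "x \<in> A" for x
    using assms that unfolding absolute_value_on_def
    by (simp add: numeral_2_eq_2 unt_right)
qed

lemma vector_norm_on_scale: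
  assumes "vector_norm_on A N" "c > 0"
  shows "vector_norm_on A (\<lambda>x. c * N x)"
  unfolding vector_norm_on_def
proof (intro conjI ballI allI)
  fix x y assume "x \<in> A" "y \<in> A"
  then show "c * N (x + y) \<le> c * N x + c * N y"
    using vector_norm_onD(4)[OF assms(1), of x y] assms(2)
    by (simp add: distrib_left[symmetric])
qed (use assms in \<open>auto simp: vector_norm_onD\<close>)

text \<open>Equality of infimum and supremum gives all products of unit vectors the same norm. The
  normalised unit identifies this norm as \<open>inverse (N unt)\<close>, and homogeneity extends
  the resulting product rule to all vectors.\<close>

lemma constant_product_norm_imp_absolute_value:
  assumes N: "vector_norm_on A N"
    and eq: "Inf (unit_product_norms A prd N) = Sup (unit_product_norms A prd N)"
  shows "N unt > 0" "absolute_value_on A prd (\<lambda>x. inverse (N unt) * N x)"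
proof -
  note D = vector_norm_onD[OF N]
  show pos: "N unt > 0" using D(1,2)[OF unt_closed] unt_nonzero by linarith
  \<comment> \<open>Every member lies between the infimum and the supremum, so any two members
    agree.\<close>
  have const: "e = f" if "e \<in> unit_product_norms A prd N" "f \<in> unit_product_norms A prd N" for e f
    using that eq by (metis Inf_lower Sup_upper order.trans order.antisym)
  \<comment> \<open>A sample unit vector whose square is computable from the unit law alone.\<close>
  define u where "u = inverse (N unt) *\<^sub>R unt"
  have scl: "r *\<^sub>R x \<in> A" if "x \<in> A" for r x
    using that subspace_carrier by (simp add: subspace_scale)
  have u: "u \<in> A" "N u = 1" "N (prd u u) = inverse (N unt)"
    using pos by (simp_all add: u_def scl unt_closed D(3) prd_scale_left prd_scale_right unt_left)
  have unit: "N (prd x y) = inverse (N unt)" if "x \<in> A" "y \<in> A" "N x = 1" "N y = 1" for x y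
  proof -
    have "ereal (N (prd x y)) = ereal (N (prd u u))"
      using that u(1,2) by (intro const) (auto simp: unit_product_norms_def)
    then show ?thesis using u(3) by simp
  qed
  have "N (prd x y) = inverse (N unt) * N x * N y" if xy: "x \<in> A" "y \<in> A" for x y
  proof (cases "x = 0 \<or> y = 0")
    case True
    then show ?thesis
      using prd_scale_left[OF unt_closed xy(2), of 0] prd_scale_right[OF xy(1) unt_closed, of 0]
        D(2)[of 0] subspace_0[OF subspace_carrier] by auto
  next
    case False
    then have nz: "N x > 0" "N y > 0" using D(1,2) xy by (auto simp: less_le)
    then have "N (prd (inverse (N x) *\<^sub>R x) (inverse (N y) *\<^sub>R y)) = inverse (N unt)"
      using xy by (intro unit) (simp_all add: scl D(3))
    then show ?thesis
      using xy nz by (simp add: prd_scale_left prd_scale_right prd_closed scl D(3) field_simps)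
  qed
  then show "absolute_value_on A prd (\<lambda>x. inverse (N unt) * N x)"
    using vector_norm_on_scale[OF N, of "inverse (N unt)"] pos
    unfolding absolute_value_on_def by simp
qed

text \<open>Used twice: equal shifts complete the square, opposite shifts factor a difference of
  squares.\<close>

lemma prd_shift:
  assumes "x \<in> A"
  shows "prd (x + r *\<^sub>R unt) (x + t *\<^sub>R unt) = prd x x + (r + t) *\<^sub>R x + (r * t) *\<^sub>R unt"
proof -
  note cl = subspace_add[OF subspace_carrier] subspace_scale[OF subspace_carrier] unt_closed
  have "prd (x + r *\<^sub>R unt) (x + t *\<^sub>R unt) =
      (prd x x + t *\<^sub>R x) + (r *\<^sub>R x + (r * t) *\<^sub>R unt)"
    using assms by (simp add: cl prd_add_left prd_add_right prd_scale_left prd_scale_right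
        unt_left unt_right scaleR_add_right)
  then show ?thesis by (simp only: scaleR_add_left ac_simps)
qed

section \<open>The subalgebra generated by one element\<close>

lemma generated_memI:
  "(\<And>S. unital_subalgebra S \<Longrightarrow> a \<in> S \<Longrightarrow> x \<in> S) \<Longrightarrow> x \<in> generated a"
  unfolding generated_def hull_def by blast

lemma generated_subset:
  "unital_subalgebra S \<Longrightarrow> a \<in> S \<Longrightarrow> generated a \<subseteq> S"
  unfolding generated_def hull_def by blast

lemma self_in_generated: "a \<in> generated a"
  by (rule generated_memI)

lemma unital_subalgebra_generated:
  assumes "a \<in> A"
  shows "unital_subalgebra (generated a)"
proof -
  \<comment> \<open>\<open>A\<close> itself belongs to the family being intersected, which keeps the
    hull inside \<open>A\<close>.\<close>
  have "unital_subalgebra A"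
    unfolding unital_subalgebra_def by (simp add: subspace_carrier unt_closed prd_closed)
  then have "generated a \<subseteq> A" using generated_subset assms by blast
  moreover have "subspace (generated a)"
    unfolding generated_def hull_def
    by (rule subspace_Inter) (auto simp: unital_subalgebra_def)
  moreover have "unt \<in> generated a"
    by (rule generated_memI) (simp add: unital_subalgebra_def)
  moreover have "prd x y \<in> generated a" if "x \<in> generated a" "y \<in> generated a" for x y
    using that generated_subset
    by (intro generated_memI) (meson subsetD unital_subalgebra_def)
  ultimately show ?thesis unfolding unital_subalgebra_def by blast
qed

end

section \<open>Square roots of the negated unit in locally complex algebras\<close>

context real_quadratic_algebra
begin

text \<open>Otherwise \<open>unt\<close>, \<open>a\<close> and the square of \<open>a\<close> would
  be three independent vectors in the at most two-dimensional \<open>generated a\<close>.\<close>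

lemma square_in_span:
  assumes "a \<in> A" "a \<notin> span {unt}"
  shows "prd a a \<in> span {unt, a}"
proof (rule ccontr)
  assume sq: "prd a a \<notin> span {unt, a}"
  have "independent {unt, a}"
    using assms(2) unt_nonzero independent_insert[of a "{unt}"] by (simp add: insert_commute)
  then have "independent {prd a a, unt, a}"
    using sq by (simp add: independent_insertI)
  moreover obtain B where B: "finite B" "card B \<le> 2" "generated a = span B"
    using generated_dim_le_2[OF assms(1)] by blast
  moreover have "{prd a a, unt, a} \<subseteq> generated a"
    using unital_subalgebra_generated[OF assms(1)] self_in_generated[of a]
    unfolding unital_subalgebra_def by blast
  ultimately have "card {prd a a, unt, a} \<le> 2"
    using independent_span_bound[of B "{prd a a, unt, a}"] by simp
  \<comment> \<open>Distinctness is what makes the cardinality three and contradicts the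
    bound.\<close>
  moreover have "unt \<noteq> a" "prd a a \<noteq> unt" "prd a a \<noteq> a"
    using assms(2) sq by (auto simp: span_base)
  ultimately show False by simp
qed

end

context locally_complex_algebra
begin

lemma generated_no_zero_divisors:
  assumes "a \<in> A" "x \<in> generated a" "y \<in> generated a" "prd x y = 0"
  shows "x = 0 \<or> y = 0"
proof -
  interpret F: field "generated_ring a" using generated_field[OF assms(1)] .
  show ?thesis using F.integral[of x y] assms by (simp add: generated_ring_def)
qed

text \<open>A nonscalar \<open>a\<close> satisfies a real quadratic equation. Completing the square
  yields a shift \<open>y\<close> of \<open>a\<close> whose square is
  \<open>d *\<^sub>R unt\<close>. Absence of zero divisors forces \<open>d < 0\<close>, so a
  rescaling of \<open>y\<close> squares to \<open>- unt\<close>.\<close>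

lemma complex_element:
  assumes a: "a \<in> A"
  shows "complex_element a"
proof (cases "a \<in> span {unt}")
  case True
  then show ?thesis unfolding complex_element_def by (auto simp: span_singleton)
next
  case False
  note cl = subspace_add[OF subspace_carrier] subspace_diff[OF subspace_carrier]
    subspace_scale[OF subspace_carrier] unt_closed prd_closed
  obtain p q where sq: "prd a a = p *\<^sub>R unt + q *\<^sub>R a"
    using square_in_span[OF a False] by (auto simp: span_insert span_singleton algebra_simps)
  \<comment> \<open>Chosen to cancel the linear coefficient \<open>q + m + m\<close> in the square
    of \<open>y\<close>.\<close>
  define m where "m = - q / 2"
  define y where "y = a + m *\<^sub>R unt"
  define d where "d = p + m\<^sup>2"
  have y: "y \<in> A" unfolding y_def using a by (intro cl)
  have a_eq: "a = y + (- m) *\<^sub>R unt" by (simp add: y_def)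
  have "prd y y = d *\<^sub>R unt + (q + m + m) *\<^sub>R a"
    unfolding y_def prd_shift[OF a] sq d_def power2_eq_square by (simp only: scaleR_add_left ac_simps)
  also have "\<dots> = d *\<^sub>R unt"
    by (simp add: m_def)
  finally have yy: "prd y y = d *\<^sub>R unt" .
  \<comment> \<open>For \<open>d\<close> at least 0 the product of \<open>y - sqrt d\<close> and
    \<open>y + sqrt d\<close> vanishes inside \<open>generated a\<close>, so one factor is 0 and
    \<open>a\<close> is a multiple of the unit.\<close>
  have "d < 0"
  proof (rule ccontr)
    assume "\<not> d < 0"
    have S: "subspace (generated a)" "unt \<in> generated a"
      using unital_subalgebra_generated[OF a] unfolding unital_subalgebra_def by auto
    have gen: "y + r *\<^sub>R unt \<in> generated a" for r
      unfolding y_def by (intro subspace_add[OF S(1)] subspace_scale[OF S(1)] self_in_generated S(2))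
    have "prd (y + (- sqrt d) *\<^sub>R unt) (y + sqrt d *\<^sub>R unt) = 0"
      unfolding prd_shift[OF y] yy using \<open>\<not> d < 0\<close> by simp
    then have "y + (- sqrt d) *\<^sub>R unt = 0 \<or> y + sqrt d *\<^sub>R unt = 0"
      using generated_no_zero_divisors[OF a gen gen] by blast
    then have "y \<in> range (\<lambda>r. r *\<^sub>R unt)"
      by (auto simp: add_eq_0_iff2 intro: range_eqI[where x = "sqrt d"] range_eqI[where x = "- sqrt d"])
    then have "a \<in> range (\<lambda>r. r *\<^sub>R unt)"
      by (auto simp only: a_eq simp flip: scaleR_add_left)
    then show False using False by (simp add: span_singleton)
  qed
  define j where "j = inverse (sqrt (- d)) *\<^sub>R y"
  have "j \<in> A" unfolding j_def using y by (intro cl)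
  moreover have "prd j j = - unt"
  proof -
    have "prd j j = (inverse (sqrt (- d)) * inverse (sqrt (- d)) * d) *\<^sub>R unt"
      unfolding j_def using y by (simp add: cl prd_scale_left prd_scale_right yy)
    also have "inverse (sqrt (- d)) * inverse (sqrt (- d)) * d = - 1"
      using \<open>d < 0\<close> by (simp flip: real_sqrt_mult inverse_mult_distrib)
    finally show ?thesis by simp
  qed
  moreover have "a = embed_complex j (Complex (- m) (sqrt (- d)))"
    using \<open>d < 0\<close> by (simp add: embed_complex_def j_def y_def)
  ultimately show ?thesis unfolding complex_element_def by blast
qed

end

section \<open>Cayley--Dickson algebras\<close>

lemma cd_fst_carrier: "cd_fst n x \<in> cd_carrier n"
  by (simp add: cd_fst_def cd_carrier_def)

lemma cd_snd_carrier: "x \<in> cd_carrier (Suc n) \<Longrightarrow> cd_snd n x \<in> cd_carrier n"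
  by (simp add: cd_snd_def cd_carrier_def)

lemma cd_pair_carrier: "b \<in> cd_carrier n \<Longrightarrow> cd_pair n a b \<in> cd_carrier (Suc n)"
  by (simp add: cd_pair_def cd_carrier_def)

lemma cd_pair_fst_snd: "cd_pair n (cd_fst n x) (cd_snd n x) = x"
  by (auto simp: cd_pair_def cd_fst_def cd_snd_def)

lemma cd_carrier_SucE:
  assumes "x \<in> cd_carrier (Suc n)"
  obtains a b where "a \<in> cd_carrier n" "b \<in> cd_carrier n" "x = cd_pair n a b"
  using that[of "cd_fst n x" "cd_snd n x"] assms
  by (simp add: cd_fst_carrier cd_snd_carrier cd_pair_fst_snd)

lemma subspace_cd_carrier: "subspace (cd_carrier n)"
  by (auto simp: subspace_def cd_carrier_def scaleR_fun_def)

lemmas cd_carrier_closed =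
  subspace_add[OF subspace_cd_carrier] subspace_diff[OF subspace_cd_carrier]
  subspace_neg[OF subspace_cd_carrier] subspace_scale[OF subspace_cd_carrier]
  subspace_0[OF subspace_cd_carrier]

lemma cd_one_carrier: "cd_one \<in> cd_carrier n"
  by (auto simp: cd_one_def cd_carrier_def)

lemma cd_one_pair: "cd_one = cd_pair n cd_one 0"
  by (auto simp: cd_one_def cd_pair_def)

text \<open>Each doubling negates the second half and recurses into the first, so only the real
  entry 0 is never negated.\<close>

lemma cd_conj_apply:
  "x \<in> cd_carrier n \<Longrightarrow> cd_conj n x i = (if i = 0 then x i else - x i)"
proof (induction n arbitrary: x i)
  case 0
  then show ?case by (simp add: cd_carrier_def)
next
  case (Suc n)
  show ?case using Suc.IH[OF cd_fst_carrier]
    by (auto simp: cd_pair_def cd_fst_def cd_snd_def)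
qed

lemma cd_conj_closed: "x \<in> cd_carrier n \<Longrightarrow> cd_conj n x \<in> cd_carrier n"
  using cd_conj_apply[of x n] by (simp add: cd_carrier_def)

lemma cd_conj_one: "cd_conj n cd_one = cd_one"
  by (auto simp: fun_eq_iff cd_conj_apply[OF cd_one_carrier]) (auto simp: cd_one_def)

section \<open>Bilinearity, closure and the unit laws\<close>

lemma cd_linear:
  "cd_fst n (x + y) = cd_fst n x + cd_fst n y" "cd_snd n (x + y) = cd_snd n x + cd_snd n y"
  "cd_fst n (r *\<^sub>R x) = r *\<^sub>R cd_fst n x" "cd_snd n (r *\<^sub>R x) = r *\<^sub>R cd_snd n x"
  by (auto simp: cd_fst_def cd_snd_def scaleR_fun_def fun_eq_iff)

lemma cd_pair_linear:
  "cd_pair n a b + cd_pair n c d = cd_pair n (a + c) (b + d)"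
  "r *\<^sub>R cd_pair n a b = cd_pair n (r *\<^sub>R a) (r *\<^sub>R b)"
  by (auto simp: cd_pair_def scaleR_fun_def fun_eq_iff)

lemma cd_conj_linear:
  "cd_conj n (x + y) = cd_conj n x + cd_conj n y"
  "cd_conj n (r *\<^sub>R x) = r *\<^sub>R cd_conj n x"
  by (induction n arbitrary: x y) (simp_all add: cd_linear cd_pair_linear)

text \<open>The induction method eta-expands the function arguments, which the simplifier would turn
  into pointwise sums; hence the restatement of the induction hypotheses.\<close>

lemma cd_mult_add:
  "cd_mult n (x + y) z = cd_mult n x z + cd_mult n y z"
  "cd_mult n z (x + y) = cd_mult n z x + cd_mult n z y"
proof (induction n arbitrary: x y z)
  case 0
  { case 1 show ?case by (auto simp: algebra_simps)
  next
    case 2 show ?case by (auto simp: algebra_simps) }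
next
  case (Suc n)
  have IH: "cd_mult n (x + y) z = cd_mult n x z + cd_mult n y z"
    "cd_mult n z (x + y) = cd_mult n z x + cd_mult n z y" for x y z
    by (rule Suc)+
  { case 1
    show "cd_mult (Suc n) (x + y) z = cd_mult (Suc n) x z + cd_mult (Suc n) y z"
      by (simp add: Let_def cd_linear cd_pair_linear IH algebra_simps)
  next
    case 2
    show "cd_mult (Suc n) z (x + y) = cd_mult (Suc n) z x + cd_mult (Suc n) z y"
      by (simp add: Let_def cd_linear cd_conj_linear cd_pair_linear IH algebra_simps) }
qed

lemma cd_mult_scale:
  "cd_mult n (r *\<^sub>R x) z = r *\<^sub>R cd_mult n x z"
  "cd_mult n z (r *\<^sub>R x) = r *\<^sub>R cd_mult n z x"
proof (induction n arbitrary: x z)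
  case 0
  { case 1 show ?case by (auto simp: scaleR_fun_def)
  next
    case 2 show ?case by (auto simp: scaleR_fun_def) }
next
  case (Suc n)
  have IH: "cd_mult n (r *\<^sub>R x) z = r *\<^sub>R cd_mult n x z"
    "cd_mult n z (r *\<^sub>R x) = r *\<^sub>R cd_mult n z x" for x z
    by (rule Suc)+
  { case 1
    show "cd_mult (Suc n) (r *\<^sub>R x) z = r *\<^sub>R cd_mult (Suc n) x z"
      by (simp add: Let_def cd_linear cd_pair_linear IH scaleR_add_right scaleR_diff_right)
  next
    case 2
    show "cd_mult (Suc n) z (r *\<^sub>R x) = r *\<^sub>R cd_mult (Suc n) z x"
      by (simp add: Let_def cd_linear cd_conj_linear cd_pair_linear IH
          scaleR_add_right scaleR_diff_right) }
qed

lemma cd_mult_minus: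
  "cd_mult n (- x) z = - cd_mult n x z"
  "cd_mult n z (- x) = - cd_mult n z x"
  using cd_mult_scale(1)[where r = "- 1"] cd_mult_scale(2)[where r = "- 1"] by simp_all

lemma cd_mult_zero: "cd_mult n 0 z = 0" "cd_mult n z 0 = 0"
  using cd_mult_scale(1)[where r = 0] cd_mult_scale(2)[where r = 0] by simp_all

lemma cd_mult_closed:
  "x \<in> cd_carrier n \<Longrightarrow> y \<in> cd_carrier n \<Longrightarrow> cd_mult n x y \<in> cd_carrier n"
proof (induction n arbitrary: x y)
  case 0
  then show ?case by (simp add: cd_carrier_def)
next
  case (Suc n)
  then show ?case
    by (auto simp: Let_def intro!: cd_pair_carrier cd_carrier_closed Suc.IH
        cd_fst_carrier cd_snd_carrier cd_conj_closed)
qed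

text \<open>One induction proves both laws: with the unit on the left, the second half of the
  doubled product is \<open>d\<close> times the unit, which calls for the right law one level
  below.\<close>

lemma cd_mult_one:
  "x \<in> cd_carrier n \<Longrightarrow> cd_mult n cd_one x = x"
  "x \<in> cd_carrier n \<Longrightarrow> cd_mult n x cd_one = x"
proof (induction n arbitrary: x)
  case 0
  { case 1 then show ?case by (auto simp: cd_carrier_def cd_one_def)
  next
    case 2 then show ?case by (auto simp: cd_carrier_def cd_one_def) }
next
  case (Suc n)
  { case 1
    then obtain a b where "a \<in> cd_carrier n" "b \<in> cd_carrier n" "x = cd_pair n a b"
      by (rule cd_carrier_SucE)
    then show ?case
      by (subst cd_one_pair[of n])
        (simp add: cd_mult_pair Suc cd_one_carrier cd_carrier_closed cd_mult_zero del: cd_mult.simps)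
  next
    case 2
    then obtain a b where "a \<in> cd_carrier n" "b \<in> cd_carrier n" "x = cd_pair n a b"
      by (rule cd_carrier_SucE)
    then show ?case
      \<comment> \<open>With scalar 0 this says \<open>cd_conj n 0 = 0\<close>; it disposes of the
        zero second half of the unit as right factor.\<close>
      using cd_conj_linear(2)[of n 0 0]
      by (subst cd_one_pair[of n])
        (simp add: cd_mult_pair Suc cd_one_carrier cd_conj_one cd_carrier_closed cd_mult_zero
          del: cd_mult.simps) }
qed

lemma real_unital_algebra_cd: "real_unital_algebra (cd_carrier n) (cd_mult n) cd_one"
proof
  show "\<exists>x\<in>cd_carrier n. x \<noteq> 0"
    by (rule bexI[OF _ cd_one_carrier]) (auto simp: cd_one_def fun_eq_iff)
qed (simp_all add: subspace_cd_carrier cd_mult_closed cd_mult_add cd_mult_scale cd_one_carrier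
    cd_mult_one)

section \<open>The Euclidean inner product and norm\<close>

definition cd_inner :: "nat \<Rightarrow> (nat \<Rightarrow> real) \<Rightarrow> (nat \<Rightarrow> real) \<Rightarrow> real" where
  "cd_inner n x y = (\<Sum>i<2 ^ n. x i * y i)"

lemma cd_inner_linear:
  "cd_inner n (x + y) z = cd_inner n x z + cd_inner n y z"
  "cd_inner n (x - y) z = cd_inner n x z - cd_inner n y z"
  "cd_inner n z (x + y) = cd_inner n z x + cd_inner n z y"
  "cd_inner n z (x - y) = cd_inner n z x - cd_inner n z y"
  by (simp_all add: cd_inner_def algebra_simps sum.distrib sum_subtractf)

lemma cd_inner_commute: "cd_inner n x y = cd_inner n y x"
  by (simp add: cd_inner_def mult.commute)

lemma cd_norm_squared: "(cd_norm n x)\<^sup>2 = cd_inner n x x"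
  by (simp add: cd_norm_def cd_inner_def power2_eq_square sum_nonneg)

lemma sum_lessThan_add:
  fixes f :: "nat \<Rightarrow> 'b::comm_monoid_add"
  shows "(\<Sum>i<m + k. f i) = (\<Sum>i<m. f i) + (\<Sum>i<k. f (m + i))"
  by (induction k) (simp_all add: add.assoc)

lemma cd_inner_pair:
  "cd_inner (Suc n) (cd_pair n a b) (cd_pair n c d) = cd_inner n a c + cd_inner n b d"
  unfolding cd_inner_def by (simp add: mult_2 sum_lessThan_add cd_pair_def)

lemma cd_inner_conj:
  "x \<in> cd_carrier n \<Longrightarrow> cd_inner n (cd_conj n x) (cd_conj n x) = cd_inner n x x"
  unfolding cd_inner_def by (rule sum.cong) (auto simp: cd_conj_apply)

text \<open>For the pair of \<open>a\<close> and \<open>b\<close>, the second half of the product is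
  \<open>b\<close> times \<open>cd_conj n a\<close> minus itself, and the first half adds the two
  instances of the induction hypothesis.\<close>

lemma cd_mult_conj_self:
  "x \<in> cd_carrier n \<Longrightarrow> cd_mult n (cd_conj n x) x = cd_inner n x x *\<^sub>R cd_one"
proof (induction n arbitrary: x)
  case 0
  then show ?case
    by (auto simp: cd_inner_def cd_one_def scaleR_fun_def cd_carrier_def fun_eq_iff)
next
  case (Suc n)
  then obtain a b where ab: "a \<in> cd_carrier n" "b \<in> cd_carrier n" "x = cd_pair n a b"
    by (auto elim: cd_carrier_SucE)
  then show ?case
    by (subst cd_one_pair[of n])
      (simp add: cd_conj_pair cd_mult_pair Suc.IH cd_conj_closed cd_carrier_closed cd_mult_minus
        cd_inner_pair cd_pair_linear scaleR_add_left del: cd_mult.simps cd_conj.simps)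
qed

lemma cd_imaginary_square:
  assumes "x \<in> cd_carrier n" "x 0 = 0"
  shows "cd_mult n x x = - (cd_inner n x x *\<^sub>R cd_one)"
proof -
  have "cd_conj n x = - x" using assms by (auto simp: fun_eq_iff cd_conj_apply)
  then show ?thesis using cd_mult_conj_self[OF assms(1)] by (metis cd_mult_minus(1) minus_minus)
qed

lemma vector_norm_on_cd_norm: "vector_norm_on (cd_carrier n) (cd_norm n)"
  unfolding vector_norm_on_def
proof (intro conjI ballI allI)
  fix x y :: "nat \<Rightarrow> real" and r :: real
  assume x: "x \<in> cd_carrier n"
  show "0 \<le> cd_norm n x" by (simp add: cd_norm_def sum_nonneg)
  show "cd_norm n x = 0 \<longleftrightarrow> x = 0"
    using x by (auto simp: cd_norm_def sum_nonneg_eq_0_iff fun_eq_iff cd_carrier_def not_less)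
      (metis lessThan_iff not_less)
  show "cd_norm n (r *\<^sub>R x) = \<bar>r\<bar> * cd_norm n x"
    by (simp add: cd_norm_def scaleR_fun_def power_mult_distrib real_sqrt_mult
        flip: sum_distrib_left)
  show "cd_norm n (x + y) \<le> cd_norm n x + cd_norm n y"
    using L2_set_triangle_ineq[of x y "{..<2 ^ n}"] by (simp add: cd_norm_def L2_set_def)
qed

section \<open>The Euclidean norm on lines and planes through the unit\<close>

context
  fixes n :: nat
begin

interpretation cd: real_unital_algebra "cd_carrier n" "cd_mult n" cd_one
  by (rule real_unital_algebra_cd)

text \<open>The condition \<open>j 0 = 0\<close> makes \<open>j\<close> orthogonal to
  \<open>cd_one\<close>, so the two are orthonormal and Pythagoras applies.\<close>

lemma cd_norm_embed_complex:
  assumes "j 0 = 0" "cd_inner n j j = 1"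
  shows "cd_norm n (cd.embed_complex j z) = cmod z"
proof -
  have *: "(\<Sum>i<2 ^ n. f i * cd_one i) = f 0" for f :: "nat \<Rightarrow> real"
    by (simp add: cd_one_def if_distrib cong: if_cong)
  have "(cd_norm n (cd.embed_complex j z))\<^sup>2 =
      (Re z)\<^sup>2 * (\<Sum>i<2 ^ n. cd_one i * cd_one i) + 2 * Re z * Im z * (\<Sum>i<2 ^ n. j i * cd_one i)
      + (Im z)\<^sup>2 * cd_inner n j j"
    unfolding cd_norm_squared cd_inner_def cd.embed_complex_def
    by (simp add: scaleR_fun_def sum_distrib_left power2_eq_square algebra_simps flip: sum.distrib)
  also have "\<dots> = (cmod z)\<^sup>2"
    by (simp add: * assms cmod_power2) (simp add: cd_one_def)
  finally show ?thesis by (simp add: cd_norm_def sum_nonneg)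
qed

text \<open>Subtracting the real part \<open>x 0\<close> leaves an imaginary element; if it is
  nonzero, dividing by its norm gives a \<open>j\<close> that squares to
  \<open>- cd_one\<close>.\<close>

lemma cd_decomposition:
  assumes x: "x \<in> cd_carrier n"
  obtains r where "x = r *\<^sub>R cd_one"
  | j z where "j \<in> cd_carrier n" "j 0 = 0" "cd_inner n j j = 1" "cd_mult n j j = - cd_one"
      "x = cd.embed_complex j z"
proof (cases "x = x 0 *\<^sub>R cd_one")
  case False
  define y where "y = x - x 0 *\<^sub>R cd_one"
  define s where "s = cd_norm n y"
  define j where "j = inverse s *\<^sub>R y"
  have y: "y \<in> cd_carrier n" unfolding y_def by (intro cd_carrier_closed x cd_one_carrier)
  have "y \<noteq> 0" using False by (simp add: y_def)
  then have s: "s > 0"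
    using vector_norm_onD(1,2)[OF vector_norm_on_cd_norm y] by (simp add: s_def less_le)
  have j: "j \<in> cd_carrier n" unfolding j_def by (intro cd_carrier_closed y)
  have j0: "j 0 = 0" by (simp add: j_def y_def scaleR_fun_def cd_one_def)
  have "cd_norm n j = 1"
    using s vector_norm_onD(3)[OF vector_norm_on_cd_norm y] by (simp add: j_def s_def)
  then have jj: "cd_inner n j j = 1" using cd_norm_squared[of n j] by simp
  have "x = cd.embed_complex j (Complex (x 0) s)"
    using s by (simp add: cd.embed_complex_def j_def y_def)
  with j j0 jj cd_imaginary_square[OF j j0] show ?thesis using that(2) by simp
qed (rule that(1))

lemma cd_complex_element: "x \<in> cd_carrier n \<Longrightarrow> cd.complex_element x"
  by (erule cd_decomposition) (auto simp: cd.complex_element_def)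

lemma cd_norm_scaled_one: "cd_norm n (r *\<^sub>R cd_one) = \<bar>r\<bar>"
proof -
  have "cd_norm n cd_one = 1"
    by (simp add: cd_norm_def cd_one_def if_distrib[of "\<lambda>x. x\<^sup>2"] cong: if_cong)
  then show ?thesis
    using vector_norm_onD(3)[OF vector_norm_on_cd_norm cd_one_carrier] by simp
qed

text \<open>Powers of \<open>x\<close> stay in the line or plane of the decomposition, where the
  norm is the absolute value or the modulus; this works at every level \<open>n\<close>.\<close>

lemma cd_norm_power:
  assumes "x \<in> cd_carrier n"
  shows "cd_norm n (alg_power (cd_mult n) cd_one x k) = cd_norm n x ^ k"
  using assms
proof (cases x rule: cd_decomposition)
  case (1 r)
  have "alg_power (cd_mult n) cd_one (r *\<^sub>R cd_one) k = r ^ k *\<^sub>R cd_one"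
    by (induction k) (simp_all add: cd_mult_scale cd_mult_one cd_one_carrier)
  then show ?thesis by (simp add: 1 cd_norm_scaled_one power_abs)
next
  case (2 j z)
  then show ?thesis
    by (simp add: cd_norm_embed_complex norm_power flip: cd.embed_complex_power)
qed

lemma power_norm_on_cd_norm: "power_norm_on (cd_carrier n) (cd_mult n) cd_one k (cd_norm n)"
  unfolding power_norm_on_def
  using vector_norm_on_cd_norm cd_norm_power cd_norm_scaled_one[of 1]
  by (auto intro!: bexI[OF _ cd_one_carrier])

lemma cd_power_norm_unique:
  assumes "k > 1" "power_norm_on (cd_carrier n) (cd_mult n) cd_one k N" "x \<in> cd_carrier n"
  shows "N x = cd_norm n x"
  using cd.power_norm_unique[OF cd_complex_element assms(1,2) power_norm_on_cd_norm] assms(3) .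

lemma cd_absolute_value_unique:
  assumes "absolute_value_on (cd_carrier n) (cd_mult n) N" "x \<in> cd_carrier n"
  shows "N x = cd_norm n x"
  using cd_power_norm_unique[OF _ cd.absolute_value_imp_power_norm] assms by simp

end

section \<open>Multiplicativity of the Euclidean norm up to the octonions\<close>

text \<open>By adjointness and associativity both sides equal the inner product of
  \<open>d (a c)\<close> with \<open>b\<close>; this fails from the octonions on.\<close>

lemma cd_inner_mult_swap:
  assumes "n \<le> 2"
    and "a \<in> cd_carrier n" "b \<in> cd_carrier n" "c \<in> cd_carrier n" "d \<in> cd_carrier n"
  shows "cd_inner n (cd_mult n a c) (cd_mult n (cd_conj n d) b) =
    cd_inner n (cd_mult n d a) (cd_mult n b (cd_conj n c))"
proof -
  \<comment> \<open>Each case is a polynomial identity in the 1, 2 or 4 real coordinates of every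
    element, verified by expansion.\<close>
  consider "n = 0" | "n = Suc 0" | "n = Suc (Suc 0)" using assms(1) by linarith
  then show ?thesis
    by cases (simp_all add: cd_inner_def Let_def cd_pair_def cd_fst_def cd_snd_def
        numeral_eq_Suc lessThan_Suc algebra_simps)
qed

text \<open>Expanding the squared norms of the two halves of the product leaves four terms that
  factor by the induction hypothesis, plus cross terms that cancel by
  \<open>cd_inner_mult_swap\<close>. That lemma applies one level lower, hence the bound 3.\<close>

lemma cd_inner_mult:
  assumes "n \<le> 3" "x \<in> cd_carrier n" "y \<in> cd_carrier n"
  shows "cd_inner n (cd_mult n x y) (cd_mult n x y) = cd_inner n x x * cd_inner n y y"
  using assms
proof (induction n arbitrary: x y)
  case 0
  then show ?case by (simp add: cd_inner_def)
next
  case (Suc n)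
  from Suc.prems obtain a b c d where
    car: "a \<in> cd_carrier n" "b \<in> cd_carrier n" "c \<in> cd_carrier n" "d \<in> cd_carrier n"
    and xy: "x = cd_pair n a b" "y = cd_pair n c d"
    by (metis cd_carrier_SucE)
  have IH: "cd_inner n (cd_mult n u v) (cd_mult n u v) = cd_inner n u u * cd_inner n v v"
    if "u \<in> cd_carrier n" "v \<in> cd_carrier n" for u v
    using Suc.IH that Suc.prems(1) by simp
  have swap: "cd_inner n (cd_mult n a c) (cd_mult n (cd_conj n d) b) =
    cd_inner n (cd_mult n d a) (cd_mult n b (cd_conj n c))"
    using cd_inner_mult_swap[OF _ car] Suc.prems(1) by simp
  \<comment> \<open>The cross terms are \<open>- 2\<close> times the inner product of
    \<open>p\<close> and \<open>q\<close> and \<open>2\<close> times that of \<open>u\<close> and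
    \<open>v\<close>.\<close>
  have expand: "cd_inner n (p - q) (p - q) + cd_inner n (u + v) (u + v) =
      cd_inner n p p + cd_inner n q q + cd_inner n u u + cd_inner n v v"
    if "cd_inner n p q = cd_inner n u v" for p q u v
    using that cd_inner_commute[of n p q] cd_inner_commute[of n u v]
    by (simp add: cd_inner_linear)
  show ?case
    unfolding xy cd_mult_pair[OF car] cd_inner_pair expand[OF swap]
    by (simp add: IH car cd_conj_closed cd_inner_conj algebra_simps)
qed

lemma absolute_value_on_cd_norm:
  assumes "n \<le> 3"
  shows "absolute_value_on (cd_carrier n) (cd_mult n) (cd_norm n)"
proof -
  have "cd_norm n (cd_mult n x y) = cd_norm n x * cd_norm n y"
    if "x \<in> cd_carrier n" "y \<in> cd_carrier n" for x y
    using cd_inner_mult[OF assms that]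
    by (simp add: cd_norm_def cd_inner_def real_sqrt_mult power2_eq_square)
  then show ?thesis unfolding absolute_value_on_def using vector_norm_on_cd_norm by blast
qed

section \<open>Uniqueness of norms\<close>

text \<open>Norm predicates see only values on \<open>A\<close>. Congruence transfers the properties
  of a known norm to any function agreeing with it on \<open>A\<close>, which gives the existence
  half of the characterisations.\<close>

lemma vector_norm_on_cong:
  assumes "subspace A" "\<And>x. x \<in> A \<Longrightarrow> N x = N' x"
  shows "vector_norm_on A N \<longleftrightarrow> vector_norm_on A N'"
  unfolding vector_norm_on_def
  using assms by (simp add: subspace_add subspace_scale)

lemma power_norm_on_cong:
  assumes "real_unital_algebra A prd unt" "\<And>x. x \<in> A \<Longrightarrow> N x = N' x"
  shows "power_norm_on A prd unt k N \<longleftrightarrow> power_norm_on A prd unt k N'"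
proof -
  interpret real_unital_algebra A prd unt by fact
  show ?thesis unfolding power_norm_on_def
    using vector_norm_on_cong[OF subspace_carrier assms(2)] assms(2) by (simp add: alg_power_closed)
qed

lemma absolute_value_on_cong:
  assumes "real_unital_algebra A prd unt" "\<And>x. x \<in> A \<Longrightarrow> N x = N' x"
  shows "absolute_value_on A prd N \<longleftrightarrow> absolute_value_on A prd N'"
proof -
  interpret real_unital_algebra A prd unt by fact
  show ?thesis unfolding absolute_value_on_def
    using vector_norm_on_cong[OF subspace_carrier assms(2)] assms(2) by (simp add: prd_closed)
qed

section \<open>Absolute values on the real and complex numbers\<close>

lemma real_unital_algebra_UNIV:
  "real_unital_algebra (UNIV :: 'b::real_normed_algebra_1 set) (*) 1"
  by standard (auto simp: algebra_simps intro: exI[of _ 1])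

lemma absolute_value_on_norm:
  "absolute_value_on (UNIV :: 'b::real_normed_div_algebra set) (*) norm"
  by (simp add: absolute_value_on_def vector_norm_on_def norm_mult norm_triangle_ineq)

lemma real_absolute_value_iff:
  "absolute_value_on (UNIV :: real set) (*) N \<longleftrightarrow> (\<forall>x. N x = norm x)"
proof
  assume N: "absolute_value_on (UNIV :: real set) (*) N"
  interpret real_unital_algebra "UNIV :: real set" "(*)" 1 by (rule real_unital_algebra_UNIV)
  show "\<forall>x. N x = norm x"
    using power_norm_scaled_unt[OF _ absolute_value_imp_power_norm[OF N]] by simp
next
  assume "\<forall>x. N x = norm x"
  then show "absolute_value_on (UNIV :: real set) (*) N"
    using absolute_value_on_norm absolute_value_on_cong[OF real_unital_algebra_UNIV] by metis
qed

lemma complex_absolute_value_iff: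
  "absolute_value_on (UNIV :: complex set) (*) N \<longleftrightarrow> (\<forall>x. N x = norm x)"
proof
  assume "absolute_value_on (UNIV :: complex set) (*) N"
  then show "\<forall>x. N x = norm x"
    using complex_power_norm_unique[of N 2]
    by (simp add: absolute_value_on_def power2_eq_square)
next
  assume "\<forall>x. N x = norm x"
  then show "absolute_value_on (UNIV :: complex set) (*) N"
    using absolute_value_on_norm absolute_value_on_cong[OF real_unital_algebra_UNIV] by metis
qed

section \<open>Uniqueness in locally complex algebras and the final assembly\<close>

lemma (in locally_complex_algebra) absolute_value_unique:
  assumes "absolute_value_on A prd N" "absolute_value_on A prd N'" "x \<in> A"
  shows "N x = N' x"
  using power_norm_unique[OF complex_element[OF assms(3)] _
      absolute_value_imp_power_norm[OF assms(1)] absolute_value_imp_power_norm[OF assms(2)]]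
  by simp

lemma (in locally_complex_algebra) constant_product_norm_unique:
  assumes "vector_norm_on A N"
    "Inf (unit_product_norms A prd N) = Sup (unit_product_norms A prd N)"
    "vector_norm_on A N'"
    "Inf (unit_product_norms A prd N') = Sup (unit_product_norms A prd N')"
  shows "\<exists>c>0. \<forall>x\<in>A. N' x = c * N x"
proof (intro exI conjI ballI)
  note N = constant_product_norm_imp_absolute_value[OF assms(1,2)]
  note N' = constant_product_norm_imp_absolute_value[OF assms(3,4)]
  \<comment> \<open>Each norm divided by its value at \<open>unt\<close> is an absolute value, and
    these coincide; the scalar is therefore the ratio of the values at \<open>unt\<close>.\<close>
  show "N' unt / N unt > 0" using N(1) N'(1) by simp
  show "N' x = N' unt / N unt * N x" if "x \<in> A" for x
    using absolute_value_unique[OF N(2) N'(2) that] N(1) N'(1) by (simp add: field_simps)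
qed

theorem theorem4p6:
  shows
   "\<comment> \<open>(i)\<close>
    (\<forall>(A :: 'a::real_vector set) prd unt (k::nat) N N'.
       locally_complex_algebra A prd unt \<longrightarrow> k > 1 \<longrightarrow>
       power_norm_on A prd unt k N \<longrightarrow> power_norm_on A prd unt k N' \<longrightarrow>
       (\<forall>x\<in>A. N x = N' x)) \<and>
    (\<forall>(n::nat) (k::nat) N. k > 1 \<longrightarrow>
       (power_norm_on (cd_carrier n) (cd_mult n) cd_one k N \<longleftrightarrow>
        (\<forall>x\<in>cd_carrier n. N x = cd_norm n x))) \<and>
    \<comment> \<open>(ii)\<close>
    (\<forall>(A :: 'a set) prd unt N N'.
       locally_complex_algebra A prd unt \<longrightarrow>
       absolute_value_on A prd N \<longrightarrow> absolute_value_on A prd N' \<longrightarrow>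
       (\<forall>x\<in>A. N x = N' x)) \<and>
    (\<forall>N. absolute_value_on (UNIV :: real set) (*) N \<longleftrightarrow> (\<forall>x. N x = norm x)) \<and>
    (\<forall>N. absolute_value_on (UNIV :: complex set) (*) N \<longleftrightarrow> (\<forall>x. N x = norm x)) \<and>
    (\<forall>n\<in>{0, 1, 2, 3}. \<forall>N.
       absolute_value_on (cd_carrier n) (cd_mult n) N \<longleftrightarrow>
       (\<forall>x\<in>cd_carrier n. N x = cd_norm n x)) \<and>
    \<comment> \<open>(iii)\<close>
    (\<forall>(A :: 'a set) prd unt N N'.
       locally_complex_algebra A prd unt \<longrightarrow>
       vector_norm_on A N \<longrightarrow>
       Inf (unit_product_norms A prd N) = Sup (unit_product_norms A prd N) \<longrightarrow>
       vector_norm_on A N' \<longrightarrow>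
       Inf (unit_product_norms A prd N') = Sup (unit_product_norms A prd N') \<longrightarrow>
       (\<exists>c>0. \<forall>x\<in>A. N' x = c * N x))"
proof (intro conjI allI impI ballI)
  fix A :: "'a set" and prd unt k N N' x
  assume "locally_complex_algebra A prd unt" "k > (1::nat)"
    "power_norm_on A prd unt k N" "power_norm_on A prd unt k N'" "x \<in> A"
  then show "N x = N' x"
    by (meson locally_complex_algebra.complex_element locally_complex_algebra.axioms(1)
        real_quadratic_algebra.axioms(1) real_unital_algebra.power_norm_unique)
next
  fix n k :: nat and N :: "(nat \<Rightarrow> real) \<Rightarrow> real"
  assume "k > 1"
  then show "power_norm_on (cd_carrier n) (cd_mult n) cd_one k N \<longleftrightarrow>
      (\<forall>x\<in>cd_carrier n. N x = cd_norm n x)"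
    using cd_power_norm_unique power_norm_on_cd_norm
      power_norm_on_cong[OF real_unital_algebra_cd, of n N "cd_norm n"] by blast
next
  fix A :: "'a set" and prd unt N N' x
  assume "locally_complex_algebra A prd unt"
    "absolute_value_on A prd N" "absolute_value_on A prd N'" "x \<in> A"
  then show "N x = N' x" by (rule locally_complex_algebra.absolute_value_unique)
next
  fix n :: nat and N :: "(nat \<Rightarrow> real) \<Rightarrow> real"
  assume "n \<in> {0, 1, 2, 3}"
  then have "n \<le> 3" by auto
  then show "absolute_value_on (cd_carrier n) (cd_mult n) N \<longleftrightarrow>
      (\<forall>x\<in>cd_carrier n. N x = cd_norm n x)"
    using cd_absolute_value_unique absolute_value_on_cd_norm
      absolute_value_on_cong[OF real_unital_algebra_cd, of n N "cd_norm n"] by blast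
next
  fix A :: "'a set" and prd unt N N'
  assume "locally_complex_algebra A prd unt" "vector_norm_on A N"
    "Inf (unit_product_norms A prd N) = Sup (unit_product_norms A prd N)" "vector_norm_on A N'"
    "Inf (unit_product_norms A prd N') = Sup (unit_product_norms A prd N')"
  then show "\<exists>c>0. \<forall>x\<in>A. N' x = c * N x"
    by (rule locally_complex_algebra.constant_product_norm_unique)
qed (fact real_absolute_value_iff complex_absolute_value_iff)+

end
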